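(* Let $(X,\|\cdot\|_X)$ and $(Y,\|\cdot\|_Y)$ be Banach spaces. Suppose that $\alpha,\beta:[0,\infty)\to[0,\infty)$ are increasing functions, that $\beta$ is concave, and that $\lim_{t\to0}\alpha(t)=\lim_{t\to0}\beta(t)=0$. Suppose also that there exists a mapping $\phi:B_X\to Y$ that satisfies $$\forall\,x,y\in B_X,\qquad \alpha(\|x-y\|_X)\le\|\phi(x)-\phi(y)\|_Y\le\beta(\|x-y\|_X).$$ Then for every $q\in[1,\infty)$, every integer $n\ge2$, and every symmetric stochastic matrix $A\in M_n(\mathbb R)$ we have $$\gamma\big(A,\|\cdot\|_X^q\big)\le 8^{q+1}\gamma\big(A,\|\cdot\|_Y^q\big)+\frac{8^q}{\beta^{-1}\!\left(\dfrac{\alpha(1/4)}{8\,\gamma(A,\|\cdot\|_Y^q)^{1/q}}\right)^{q}} .$$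
   Context: Banach spaces are assumed nonzero. $B_X=\{x\in X:\|x\|_X\le1\}$ is the closed unit ball. "Increasing" means strictly increasing, and $\beta^{-1}$ is the inverse function of $\beta$ on its range. An $n\times n$ real matrix $A=(a_{ij})$ is symmetric stochastic if it is symmetric, has nonnegative entries, and each row sums to $1$. For a Banach space $(W,\|\cdot\|_W)$, $\gamma(A,\|\cdot\|_W^q)$ is the infimum over those $\gamma\in(0,\infty]$ such that for every $x_1,\ldots,x_n\in W$, $$\frac1{n^2}\sum_{i=1}^n\sum_{j=1}^n \|x_i-x_j\|_W^q\le \frac{\gamma}{n}\sum_{i=1}^n\sum_{j=1}^n a_{ij}\|x_i-x_j\|_W^q$$ ($\gamma=\infty$ is always admissible). If $\gamma(A,\|\cdot\|_Y^q)=\infty$ the right hand side of the conclusion is interpreted as $\infty$. *)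

theory Defs
  imports "HOL-Analysis.Analysis"
begin

definition symmetric_stochastic :: "real ^ 'n ^ 'n \<Rightarrow> bool" where
  "symmetric_stochastic A \<longleftrightarrow>
     transpose A = A \<and> (\<forall>i j. 0 \<le> A $ i $ j) \<and> (\<forall>i. (\<Sum>j\<in>UNIV. A $ i $ j) = 1)"

text \<open>
  The second argument \<open>K\<close> is the power of the norm, \<open>\<lambda>w. norm w powr q\<close>; it also determines the
  space from which the points are taken. The value \<open>\<infinity>\<close> is inserted explicitly because it is
  always admissible, whereas \<open>\<infinity> * 0 = 0\<close> in \<^typ>\<open>ennreal\<close>.
\<close>

definition spectral_gap_const :: "real ^ 'n ^ 'n \<Rightarrow> ('w::real_normed_vector \<Rightarrow> real) \<Rightarrow> ennreal"
  where
  "spectral_gap_const A K = Inf (insert \<infinity> {ennreal g | g :: real. 0 < g \<and>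
     (\<forall>x :: 'n \<Rightarrow> 'w.
        1 / (real CARD('n))\<^sup>2 * (\<Sum>i\<in>UNIV. \<Sum>j\<in>UNIV. K (x i - x j))
        \<le> g / real CARD('n) * (\<Sum>i\<in>UNIV. \<Sum>j\<in>UNIV. A $ i $ j * K (x i - x j)))})"

end

theory Submission
  imports Defs
begin

text \<open>
  Let \<open>R\<close> be the smallest radius of a ball centred at some \<open>x c\<close> that contains half of the points.
  The excess \<open>f i\<close> of the distance from \<open>x i\<close> to \<open>x c\<close> over \<open>R\<close> is a real function vanishing on half of
  the indices, and \<open>Y\<close> contains a line, so the Poincare inequality of \<open>Y\<close> controls the mean of \<open>f\<^sup>q\<close>.
  To bound \<open>R\<close>, retract the points \<open>(x i - x c) / (2 R)\<close> radially to the unit ball and apply the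
  Poincare inequality of \<open>Y\<close> to their images under \<open>\<phi>\<close>; concavity gives
  \<open>\<beta> t \<le> \<beta> s * max 1 (t / s)\<close>. If \<open>R\<close> were too large compared with the energy of \<open>x\<close>, three quarters of the
  pairs of retracted points would be at distance less than 1/4, and half of the points would lie in
  a ball of radius \<open>R / 2\<close> about some \<open>x i\<close>.
\<close>

section \<open>The Poincare inequality: its best constant and scalar test functions\<close>

text \<open>The inequality is multiplied through by the square of the cardinality. Positivity of
  \<open>g\<close> is imposed only where the infimum is taken, so that the infimum itself can be
  inserted for \<open>g\<close>.\<close>

definition poincare :: "real ^ 'n ^ 'n \<Rightarrow> ('w::real_normed_vector \<Rightarrow> real) \<Rightarrow> real \<Rightarrow> bool" where
  "poincare A K g \<longleftrightarrow> (\<forall>x :: 'n \<Rightarrow> 'w.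
     (\<Sum>i\<in>UNIV. \<Sum>j\<in>UNIV. K (x i - x j))
     \<le> g * real CARD('n) * (\<Sum>i\<in>UNIV. \<Sum>j\<in>UNIV. A $ i $ j * K (x i - x j)))"

lemma spectral_gap_const_eq_Inf_poincare:
  fixes A :: "real ^ 'n ^ 'n"
  shows "spectral_gap_const A K = Inf (insert \<infinity> {ennreal g | g. 0 < g \<and> poincare A K g})"
  (is "_ = Inf (insert _ ?S)")
proof -
  have "1 / (real CARD('n))\<^sup>2 * s \<le> g / real CARD('n) * t \<longleftrightarrow> s \<le> g * real CARD('n) * t"
    for s t g
  proof -
    have n: "real CARD('n) > 0" by simp
    have "1 / (real CARD('n))\<^sup>2 * s \<le> g / real CARD('n) * t
        \<longleftrightarrow> (real CARD('n))\<^sup>2 * (1 / (real CARD('n))\<^sup>2 * s)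
          \<le> (real CARD('n))\<^sup>2 * (g / real CARD('n) * t)"
      using n by (subst mult_le_cancel_left_pos) auto
    also have "(real CARD('n))\<^sup>2 * (g / real CARD('n) * t) = g * real CARD('n) * t"
      using n by (simp add: power2_eq_square)
    also have "(real CARD('n))\<^sup>2 * (1 / (real CARD('n))\<^sup>2 * s) = s"
      using n by simp
    finally show ?thesis .
  qed
  then show ?thesis
    unfolding spectral_gap_const_def poincare_def by simp
qed

lemma spectral_gap_const_le:
  assumes "0 < g" "poincare A K g"
  shows "spectral_gap_const A K \<le> ennreal g"
  unfolding spectral_gap_const_eq_Inf_poincare using assms by (intro Inf_lower) auto

text \<open>A finite infimum is attained. Every \<open>c + e\<close> with \<open>e > 0\<close>
  exceeds some admissible constant, and the right hand side is monotone and continuous in the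
  constant, so \<open>e\<close> can tend to 0.\<close>

lemma poincare_spectral_gap_const:
  fixes A :: "real ^ 'n ^ 'n"
  assumes fin: "spectral_gap_const A K \<noteq> \<infinity>"
    and A: "\<And>i j. 0 \<le> A $ i $ j" and K: "\<And>w. 0 \<le> K w"
  shows "poincare A K (enn2real (spectral_gap_const A K))"
  unfolding poincare_def
proof
  fix x :: "'n \<Rightarrow> 'a"
  define S where "S = (\<Sum>i\<in>UNIV. \<Sum>j\<in>UNIV. K (x i - x j))"
  define T where "T = real CARD('n) * (\<Sum>i\<in>UNIV. \<Sum>j\<in>UNIV. A $ i $ j * K (x i - x j))"
  define c where "c = enn2real (spectral_gap_const A K)"
  have c: "spectral_gap_const A K = ennreal c"
    using fin unfolding c_def by (simp add: top.not_eq_extremum)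
  have T: "0 \<le> T" unfolding T_def by (intro mult_nonneg_nonneg sum_nonneg) (auto simp: A K)
  have c0: "0 \<le> c" by (simp add: c_def)
  have *: "S \<le> (c + e) * T" if "0 < e" for e
  proof -
    have "Inf (insert \<infinity> {ennreal g | g. 0 < g \<and> poincare A K g}) < ennreal (c + e)"
      unfolding spectral_gap_const_eq_Inf_poincare[symmetric] c
      using that c0 by (simp add: ennreal_less_iff)
    then obtain g where g: "0 < g" "poincare A K g" "ennreal g < ennreal (c + e)"
      unfolding Inf_less_iff by auto
    have "S \<le> g * T" using g(2) unfolding poincare_def S_def T_def
      by (simp add: mult.assoc)
    also have "\<dots> \<le> (c + e) * T"
      using g c0 that T by (intro mult_right_mono) (auto simp: ennreal_less_iff simp del: ennreal_plus)
    finally show ?thesis .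
  qed
  have "S \<le> c * T"
  proof (rule tendsto_lowerbound)
    show "((\<lambda>e. (c + e) * T) \<longlongrightarrow> c * T) (at_right 0)"
      by (auto intro!: tendsto_eq_intros)
    show "\<forall>\<^sub>F e in at_right 0. S \<le> (c + e) * T"
      using * by (auto simp: eventually_at_right_less eventually_at_filter)
  qed simp
  then show "S \<le> enn2real (spectral_gap_const A K) * real CARD('n) *
      (\<Sum>i\<in>UNIV. \<Sum>j\<in>UNIV. A $ i $ j * K (x i - x j))"
    unfolding c_def T_def by (simp add: mult.assoc)
qed

text \<open>The map \<open>t \<mapsto> t *\<^sub>R y\<close> embeds the real line in the space up to
  the factor \<open>norm y\<close>, whose power cancels from both sides.\<close>

lemma poincare_real:
  fixes A :: "real ^ 'n ^ 'n" and f :: "'n \<Rightarrow> real"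
  assumes P: "poincare A (\<lambda>w::'y::real_normed_vector. norm w powr q) g"
    and y: "(y::'y) \<noteq> 0"
  shows "(\<Sum>i\<in>UNIV. \<Sum>j\<in>UNIV. \<bar>f i - f j\<bar> powr q)
     \<le> g * real CARD('n) * (\<Sum>i\<in>UNIV. \<Sum>j\<in>UNIV. A $ i $ j * \<bar>f i - f j\<bar> powr q)"
proof -
  have eq: "norm (f i *\<^sub>R y - f j *\<^sub>R y) powr q = norm y powr q * \<bar>f i - f j\<bar> powr q" for i j
    by (simp add: scaleR_left_diff_distrib[symmetric] powr_mult)
  have "norm y powr q * (\<Sum>i\<in>UNIV. \<Sum>j\<in>UNIV. \<bar>f i - f j\<bar> powr q)
     \<le> norm y powr q * (g * real CARD('n)
          * (\<Sum>i\<in>UNIV. \<Sum>j\<in>UNIV. A $ i $ j * \<bar>f i - f j\<bar> powr q))"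
    using P[unfolded poincare_def, rule_format, of "\<lambda>i. f i *\<^sub>R y"]
    unfolding eq by (simp add: sum_distrib_left algebra_simps)
  then show ?thesis
    using y by (subst (asm) mult_le_cancel_left_pos) auto
qed

text \<open>Testing with the indicator of a single index gives \<open>2 * n - 2\<close> on the left
  and an energy of at most 2 on the right, so \<open>g\<close> is at least
  \<open>(n - 1) / n\<close>. This lower bound later places the argument of the inverse of
  \<open>\<beta>\<close> in its range.\<close>

lemma poincare_ge_half:
  fixes A :: "real ^ 'n ^ 'n"
  assumes P: "poincare A (\<lambda>w::'y::real_normed_vector. norm w powr q) g"
    and y: "(y::'y) \<noteq> 0" and A: "symmetric_stochastic A" and n: "2 \<le> CARD('n)" and g: "0 \<le> g"
  shows "1 / 2 \<le> g"
proof -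
  have row: "(\<Sum>j\<in>UNIV. A $ i $ j) = 1" and nn: "0 \<le> A $ i $ j" for i j
    using A by (auto simp: symmetric_stochastic_def)
  have sym: "A $ i $ j = A $ j $ i" for i j
  proof -
    have "transpose A $ i $ j = A $ i $ j"
      using A unfolding symmetric_stochastic_def by simp
    then show ?thesis by (simp add: transpose_def)
  qed
  obtain a :: 'n where True by simp
  define f :: "'n \<Rightarrow> real" where "f i = of_bool (i = a)" for i
  \<comment> \<open>The differences have modulus 0 or 1, and \<open>0 powr q = 0\<close> and
    \<open>1 powr q = 1\<close> for every \<open>q\<close>.\<close>
  have pw: "\<bar>f i - f j\<bar> powr q = f i + f j - 2 * f i * f j" for i j
    by (simp add: f_def)
  have f1: "(\<Sum>i\<in>UNIV. f i) = 1" by (simp add: f_def of_bool_def)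
  let ?n = "real CARD('n)"
  have "(\<Sum>i\<in>UNIV. \<Sum>j\<in>UNIV. \<bar>f i - f j\<bar> powr q) = 2 * ?n - 2"
    unfolding pw
    by (simp add: sum.distrib sum_subtractf f1 mult.assoc
        flip: sum_distrib_left sum_distrib_right)
  moreover have "(\<Sum>i\<in>UNIV. \<Sum>j\<in>UNIV. A $ i $ j * \<bar>f i - f j\<bar> powr q) \<le> 2"
  proof -
    have "(\<Sum>i\<in>UNIV. \<Sum>j\<in>UNIV. A $ i $ j * \<bar>f i - f j\<bar> powr q)
      \<le> (\<Sum>i\<in>UNIV. \<Sum>j\<in>UNIV. f i * A $ i $ j + f j * A $ j $ i)"
      unfolding pw using nn
      by (intro sum_mono) (auto simp: f_def sym algebra_simps)
    also have "\<dots> = (\<Sum>i\<in>UNIV. \<Sum>j\<in>UNIV. f i * A $ i $ j) + (\<Sum>j\<in>UNIV. \<Sum>i\<in>UNIV. f j * A $ j $ i)"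
      unfolding sum.distrib by (subst (2) sum.swap) simp
    also have "\<dots> = 2"
      by (simp add: row f1 flip: sum_distrib_left)
    finally show ?thesis .
  qed
  then have "g * ?n * (\<Sum>i\<in>UNIV. \<Sum>j\<in>UNIV. A $ i $ j * \<bar>f i - f j\<bar> powr q) \<le> g * ?n * 2"
    using g by (intro mult_left_mono) auto
  ultimately have "2 * ?n - 2 \<le> g * ?n * 2"
    using poincare_real[OF P y, of f] by linarith
  then have "?n - 1 \<le> g * ?n" by simp
  moreover have "?n / 2 \<le> ?n - 1" using n by simp
  ultimately have "(1/2) * ?n \<le> g * ?n" by linarith
  then show ?thesis by (subst (asm) mult_le_cancel_right_pos) auto
qed

text \<open>A pair with one index in \<open>Z\<close> contributes the full power of \<open>f\<close>
  at the other index. Both orders together give \<open>2 * card Z\<close> copies of the sum.\<close>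

lemma sum_powr_le_sum_diff_powr:
  fixes f :: "'n::finite \<Rightarrow> real"
  assumes f: "\<And>i. 0 \<le> f i" and Z: "\<And>i. i \<in> Z \<Longrightarrow> f i = 0"
    and card: "CARD('n) \<le> 2 * card Z"
  shows "real CARD('n) * (\<Sum>i\<in>UNIV. f i powr q) \<le> (\<Sum>i\<in>UNIV. \<Sum>j\<in>UNIV. \<bar>f i - f j\<bar> powr q)"
proof -
  let ?S = "\<Sum>i\<in>UNIV. f i powr q"
  have "real CARD('n) * ?S \<le> real (2 * card Z) * ?S"
    using card by (intro mult_right_mono sum_nonneg) (auto simp only: of_nat_le_iff powr_ge_zero)
  also have "\<dots> = (\<Sum>i\<in>UNIV. \<Sum>j\<in>UNIV. indicator Z j * f i powr q)
      + (\<Sum>i\<in>UNIV. \<Sum>j\<in>UNIV. indicator Z i * f j powr q)"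
    by (simp flip: sum_distrib_left sum_distrib_right)
       (simp add: indicator_def of_bool_def sum.If_cases)
  also have "\<dots> = (\<Sum>i\<in>UNIV. \<Sum>j\<in>UNIV. indicator Z j * f i powr q + indicator Z i * f j powr q)"
    by (simp add: sum.distrib)
  also have "\<dots> \<le> (\<Sum>i\<in>UNIV. \<Sum>j\<in>UNIV. \<bar>f i - f j\<bar> powr q)"
    using f Z by (intro sum_mono) (auto simp: indicator_def)
  finally show ?thesis .
qed

section \<open>Radial retraction to the unit ball, and growth of concave moduli\<close>

definition radial :: "'a::real_normed_vector \<Rightarrow> 'a" where
  "radial x = x /\<^sub>R max 1 (norm x)"

lemma norm_radial_le: "norm (radial x) \<le> 1"
  by (simp add: radial_def field_simps)

lemma radial_eq_self: "norm x \<le> 1 \<Longrightarrow> radial x = x"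
  by (simp add: radial_def)

lemma norm_radial_eq_one: "1 \<le> norm x \<Longrightarrow> norm (radial x) = 1"
  by (cases "x = 0") (auto simp: radial_def max_def)

text \<open>The difference splits into a change of the vector over a fixed denominator and a change
  of the denominator. Each part is at most \<open>norm (x - y)\<close>, since
  \<open>max 1 (norm x)\<close> is 1-Lipschitz and at least 1.\<close>

lemma radial_lipschitz: "norm (radial x - radial y) \<le> 2 * norm (x - y)"
proof -
  define a where "a = max 1 (norm x)"
  define b where "b = max 1 (norm y)"
  have ab: "1 \<le> a" "1 \<le> b" by (auto simp: a_def b_def)
  have "radial x - radial y = (x - y) /\<^sub>R a + ((b - a) / a) *\<^sub>R radial y"
  proof -
    have "((b - a) / a) *\<^sub>R radial y = (1/a - 1/b) *\<^sub>R y"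
      using ab unfolding radial_def b_def[symmetric] by (simp add: field_simps)
    then show ?thesis
      unfolding radial_def a_def[symmetric] b_def[symmetric]
      by (simp add: scaleR_left_diff_distrib scaleR_right_diff_distrib inverse_eq_divide)
  qed
  then have "norm (radial x - radial y) \<le> norm (x - y) / a + \<bar>b - a\<bar> / a * norm (radial y)"
    using norm_triangle_ineq[of "(x - y) /\<^sub>R a" "((b - a) / a) *\<^sub>R radial y"] ab
    by (simp add: divide_inverse_commute abs_mult)
  also have "\<dots> \<le> norm (x - y) / 1 + norm (x - y) / 1 * 1"
  proof (intro add_mono mult_mono frac_le)
    show "\<bar>b - a\<bar> \<le> norm (x - y)"
      using norm_triangle_ineq3[of x y] by (auto simp: a_def b_def)
  qed (use ab norm_radial_le in auto)
  finally show ?thesis by simp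
qed

text \<open>For \<open>t > s\<close> the point \<open>s\<close> is a convex combination of 0 and
  \<open>t\<close>, so \<open>\<beta> t / t \<le> \<beta> s / s\<close>. The maximum of 1 and the
  power of \<open>t / s\<close> is replaced by their sum, which separates into a constant and an
  energy term when weighted by \<open>A\<close>.\<close>

lemma concave_powr_bound:
  fixes \<beta> :: "real \<Rightarrow> real"
  assumes conc: "concave_on {0..} \<beta>" and mono: "mono_on {0..} \<beta>" and "0 \<le> \<beta> 0"
    and "0 < s" "0 \<le> t" "0 \<le> q"
  shows "\<beta> t powr q \<le> \<beta> s powr q * (1 + (t / s) powr q)"
proof -
  have \<beta>t: "0 \<le> \<beta> t" and \<beta>s: "0 \<le> \<beta> s"
    using assms(3-5) monotone_onD[OF mono, of 0 t] monotone_onD[OF mono, of 0 s] by auto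
  show ?thesis
  proof (cases "t \<le> s")
    case True
    then have "\<beta> t powr q \<le> \<beta> s powr q * 1"
      using assms \<beta>t monotone_onD[OF mono, of t s] by (auto intro!: powr_mono2)
    also have "\<dots> \<le> \<beta> s powr q * (1 + (t / s) powr q)"
      by (intro mult_left_mono) auto
    finally show ?thesis .
  next
    case False
    then have ts: "0 < t" "s < t" "0 < s" using assms by auto
    have "(1 - s/t) * \<beta> 0 + (s/t) * \<beta> t \<le> \<beta> ((1 - s/t) *\<^sub>R 0 + (s/t) *\<^sub>R t)"
      using ts by (intro concave_onD[OF conc]) auto
    then have "(1 - s/t) * \<beta> 0 + (s/t) * \<beta> t \<le> \<beta> s" using ts by simp
    moreover have "0 \<le> (1 - s/t) * \<beta> 0" using ts assms by (intro mult_nonneg_nonneg) auto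
    ultimately have "(s/t) * \<beta> t \<le> \<beta> s" by linarith
    then have "\<beta> t \<le> \<beta> s * (t / s)" using ts by (simp add: field_simps)
    then have "\<beta> t powr q \<le> (\<beta> s * (t / s)) powr q"
      using \<beta>t assms by (intro powr_mono2) auto
    also have "\<dots> = \<beta> s powr q * (t / s) powr q"
      using \<beta>s ts by (subst powr_mult) auto
    also have "\<dots> \<le> \<beta> s powr q * (1 + (t / s) powr q)"
      by (intro mult_left_mono) auto
    finally show ?thesis .
  qed
qed

section \<open>Balls containing half of the points, and counting of pairs\<close>

text \<open>The least radius exists because only finitely many radii compete: a ball can be shrunk,
  without losing points, until its radius is the largest distance from its centre to a point in
  it.\<close>

lemma ex_half_ball:
  fixes x :: "'n::finite \<Rightarrow> 'a::real_normed_vector"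
  obtains c R where "0 \<le> R" "CARD('n) \<le> 2 * card {j. norm (x j - x c) \<le> R}"
    "\<And>i r. CARD('n) \<le> 2 * card {j. norm (x j - x i) \<le> r} \<Longrightarrow> R \<le> r"
proof -
  define V where "V = {d. \<exists>i k. d = norm (x k - x i) \<and> CARD('n) \<le> 2 * card {j. norm (x j - x i) \<le> d}}"
  have finV: "finite V"
    by (rule finite_subset[of _ "range (\<lambda>(i,k). norm (x k - x i))"]) (auto simp: V_def)
  have V: "\<exists>d\<in>V. d \<le> r" if h: "CARD('n) \<le> 2 * card {j. norm (x j - x i) \<le> r}" for i r
  proof -
    define B where "B = {j. norm (x j - x i) \<le> r}"
    have "0 < CARD('n)" by simp
    then have "0 < card B" using h unfolding B_def by linarith
    then have "B \<noteq> {}" by auto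
    define d where "d = Max ((\<lambda>j. norm (x j - x i)) ` B)"
    have d: "d \<in> (\<lambda>j. norm (x j - x i)) ` B"
      unfolding d_def using \<open>B \<noteq> {}\<close> by (intro Max_in) auto
    then obtain k where k: "d = norm (x k - x i)" "d \<le> r" by (auto simp: B_def)
    have "norm (x j - x i) \<le> d" if "j \<in> B" for j
      unfolding d_def using that by (intro Max_ge) auto
    then have "B \<subseteq> {j. norm (x j - x i) \<le> d}" by auto
    then have "card B \<le> card {j. norm (x j - x i) \<le> d}" by (intro card_mono) auto
    then have "d \<in> V" using h k unfolding V_def B_def by fastforce
    then show ?thesis using k by auto
  qed
  obtain a :: 'n where True by simp
  \<comment> \<open>The sum of all distances from \<open>x a\<close> is a radius that captures every
    point, so there is a candidate.\<close>
  have "{j. norm (x j - x a) \<le> (\<Sum>k\<in>UNIV. norm (x k - x a))} = UNIV"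
    by (auto intro: member_le_sum)
  then have "V \<noteq> {}" using V[of a "\<Sum>k\<in>UNIV. norm (x k - x a)"] by auto
  then have "Min V \<in> V" using finV by simp
  then obtain c where "0 \<le> Min V" "CARD('n) \<le> 2 * card {j. norm (x j - x c) \<le> Min V}"
    by (auto simp: V_def)
  moreover have "Min V \<le> r" if "CARD('n) \<le> 2 * card {j. norm (x j - x i) \<le> r}" for i r
    using V[OF that] finV by (meson Min_le order_trans)
  ultimately show thesis using that by blast
qed

text \<open>Double counting: otherwise each row in \<open>S\<close> has more than
  \<open>n / 2\<close> failures, and at least \<open>n / 2\<close> such rows give more than a
  quarter of all pairs.\<close>

lemma ex_half_row:
  fixes Q :: "'n::finite \<Rightarrow> 'n \<Rightarrow> bool"
  assumes S: "CARD('n) \<le> 2 * card S"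
    and Q: "4 * real (card {(i, j). \<not> Q i j}) \<le> (real CARD('n))\<^sup>2"
  shows "\<exists>i\<in>S. CARD('n) \<le> 2 * card {j. Q i j}"
proof (rule ccontr)
  assume neg: "\<not> ?thesis"
  let ?n = "real CARD('n)"
  have row: "?n / 2 < real (card {j. \<not> Q i j})" if "i \<in> S" for i
  proof -
    have "{j. \<not> Q i j} = UNIV - {j. Q i j}" by auto
    then have "card {j. \<not> Q i j} + card {j. Q i j} = CARD('n)"
      by (simp add: card_Diff_subset card_mono)
    moreover have "2 * card {j. Q i j} < CARD('n)" using neg that by force
    ultimately show ?thesis by linarith
  qed
  have "S \<noteq> {}" using S by auto
  have "?n\<^sup>2 / 4 \<le> real (card S) * (?n / 2)"
  proof -
    have "?n \<le> 2 * real (card S)" using S by linarith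
    then have "?n * ?n \<le> 2 * real (card S) * ?n" by (intro mult_right_mono) auto
    then show ?thesis by (simp add: power2_eq_square)
  qed
  also have "\<dots> = (\<Sum>i\<in>S. ?n / 2)" by simp
  also have "\<dots> < (\<Sum>i\<in>S. real (card {j. \<not> Q i j}))"
    using \<open>S \<noteq> {}\<close> row by (intro sum_strict_mono) auto
  also have "\<dots> = real (card (SIGMA i:S. {j. \<not> Q i j}))"
    by (simp add: card_SigmaI)
  also have "\<dots> \<le> real (card {(i, j). \<not> Q i j})"
    by (intro of_nat_mono card_mono) auto
  finally show False using Q by simp
qed

text \<open>A Markov type count. Each far pair adds at least \<open>\<alpha> \<delta> powr q\<close>
  to the left side of the Poincare inequality for the images under \<open>\<phi>\<close>, while
  concavity of \<open>\<beta>\<close> bounds the right side by the energy of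
  \<open>z\<close>.\<close>

lemma card_far_pairs_le:
  fixes A :: "real ^ 'n ^ 'n" and \<phi> :: "'x::real_normed_vector \<Rightarrow> 'y::real_normed_vector"
    and z :: "'n \<Rightarrow> 'x"
  assumes P: "poincare A (\<lambda>w::'y. norm w powr q) g" and g: "0 < g"
    and A: "symmetric_stochastic A"
    and \<alpha>: "mono_on {0..} \<alpha>" "0 < \<alpha> \<delta>" and \<delta>: "0 \<le> \<delta>"
    and \<beta>: "concave_on {0..} \<beta>" "mono_on {0..} \<beta>" "0 \<le> \<beta> 0"
    and \<phi>: "\<And>i j. \<alpha> (norm (z i - z j)) \<le> norm (\<phi> (z i) - \<phi> (z j))"
      "\<And>i j. norm (\<phi> (z i) - \<phi> (z j)) \<le> \<beta> (norm (z i - z j))"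
    and s: "0 < s" "\<beta> s = \<alpha> \<delta> / (8 * g powr (1/q))" and q: "0 < q"
  shows "real (card {(i, j). \<not> norm (z i - z j) < \<delta>})
    \<le> 8 powr (-q) * ((real CARD('n))\<^sup>2
        + real CARD('n) * (\<Sum>i\<in>UNIV. \<Sum>j\<in>UNIV. A $ i $ j * norm (z i - z j) powr q) / s powr q)"
proof -
  have row: "(\<Sum>j\<in>UNIV. A $ i $ j) = 1" and nn: "0 \<le> A $ i $ j" for i j
    using A by (auto simp: symmetric_stochastic_def)
  let ?n = "real CARD('n)"
  let ?T = "\<Sum>i\<in>UNIV. \<Sum>j\<in>UNIV. A $ i $ j * norm (z i - z j) powr q"
  let ?B = "{(i, j). \<not> norm (z i - z j) < \<delta>}"
  have "real (card ?B) * \<alpha> \<delta> powr q = (\<Sum>p\<in>?B. \<alpha> \<delta> powr q)" by simp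
  also have "\<dots> \<le> (\<Sum>p\<in>?B. norm (\<phi> (z (fst p)) - \<phi> (z (snd p))) powr q)"
  proof (rule sum_mono)
    fix p assume "p \<in> ?B"
    then have "\<alpha> \<delta> \<le> \<alpha> (norm (z (fst p) - z (snd p)))"
      using \<delta> by (intro monotone_onD[OF \<alpha>(1)]) auto
    then show "\<alpha> \<delta> powr q \<le> norm (\<phi> (z (fst p)) - \<phi> (z (snd p))) powr q"
      using \<phi>(1)[of "fst p" "snd p"] \<alpha>(2) q by (intro powr_mono2) auto
  qed
  also have "\<dots> \<le> (\<Sum>p\<in>UNIV. norm (\<phi> (z (fst p)) - \<phi> (z (snd p))) powr q)"
    by (intro sum_mono2) auto
  also have "\<dots> = (\<Sum>i\<in>UNIV. \<Sum>j\<in>UNIV. norm (\<phi> (z i) - \<phi> (z j)) powr q)"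
    by (simp add: sum.cartesian_product case_prod_beta)
  also have "\<dots> \<le> g * ?n * (\<Sum>i\<in>UNIV. \<Sum>j\<in>UNIV. A $ i $ j * norm (\<phi> (z i) - \<phi> (z j)) powr q)"
    using P unfolding poincare_def by (rule spec)
  also have "\<dots> \<le> g * ?n * (\<Sum>i\<in>UNIV. \<Sum>j\<in>UNIV. A $ i $ j *
      (\<beta> s powr q * (1 + (norm (z i - z j) / s) powr q)))"
  proof (intro mult_left_mono sum_mono)
    fix i j
    have "norm (\<phi> (z i) - \<phi> (z j)) powr q \<le> \<beta> (norm (z i - z j)) powr q"
      using \<phi>(2) q by (intro powr_mono2) auto
    also have "\<dots> \<le> \<beta> s powr q * (1 + (norm (z i - z j) / s) powr q)"
      using \<beta> s q by (intro concave_powr_bound) auto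
    finally show "norm (\<phi> (z i) - \<phi> (z j)) powr q
      \<le> \<beta> s powr q * (1 + (norm (z i - z j) / s) powr q)" .
  qed (use g nn in auto)
  also have "(\<Sum>i\<in>UNIV. \<Sum>j\<in>UNIV. A $ i $ j *
      (\<beta> s powr q * (1 + (norm (z i - z j) / s) powr q)))
     = (\<Sum>i\<in>UNIV. \<Sum>j\<in>UNIV. \<beta> s powr q * A $ i $ j
        + \<beta> s powr q / s powr q * (A $ i $ j * norm (z i - z j) powr q))"
    using s(1) by (intro sum.cong refl) (simp add: powr_divide algebra_simps)
  also have "\<dots> = \<beta> s powr q * (\<Sum>i\<in>UNIV. \<Sum>j\<in>UNIV. A $ i $ j) + \<beta> s powr q / s powr q * ?T"
    by (simp only: sum.distrib sum_distrib_left)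
  also have "\<dots> = \<beta> s powr q * (?n + ?T / s powr q)"
    by (simp add: row distrib_left)
  also have "g * ?n * \<dots> = g * \<beta> s powr q * (?n\<^sup>2 + ?n * ?T / s powr q)"
    by (simp add: power2_eq_square algebra_simps)
  \<comment> \<open>The choice of \<open>s\<close> is made for this: the \<open>q\<close>-th power
    undoes the root of \<open>g\<close>, so \<open>g\<close> cancels and
    \<open>\<alpha> \<delta> powr q\<close> can be divided out.\<close>
  also have "g * \<beta> s powr q = \<alpha> \<delta> powr q * 8 powr (-q)"
  proof -
    have "\<beta> s powr q = \<alpha> \<delta> powr q / (8 powr q * (g powr (1/q)) powr q)"
      using s \<alpha> g by (simp add: powr_divide powr_mult)
    then show ?thesis using q g by (simp add: powr_powr powr_minus field_simps)
  qed
  finally have "\<alpha> \<delta> powr q * real (card ?B)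
      \<le> \<alpha> \<delta> powr q * (8 powr (-q) * (?n\<^sup>2 + ?n * ?T / s powr q))"
    by (simp add: mult_ac)
  then show ?thesis
    using \<alpha> by (subst (asm) mult_le_cancel_left_pos) auto
qed

section \<open>A power inequality, and the range of a concave modulus\<close>

text \<open>The coefficients add up to 4, and the power of the maximum is one of the three
  summands.\<close>

lemma add3_powr_le:
  fixes a b c q :: real
  assumes "0 \<le> a" "0 \<le> b" "0 \<le> c" "0 \<le> q"
  shows "(2 * a + b + c) powr q \<le> 4 powr q * (a powr q + b powr q + c powr q)"
proof -
  define m where "m = max a (max b c)"
  have "(2 * a + b + c) powr q \<le> (4 * m) powr q"
    using assms by (intro powr_mono2) (auto simp: m_def)
  also have "\<dots> = 4 powr q * m powr q"
    by (rule powr_mult)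
  also have "m powr q \<le> a powr q + b powr q + c powr q"
    by (auto simp: m_def max_def)
  finally show ?thesis by simp
qed

text \<open>Concavity gives continuity on the open half line and the limit gives it at 0, so the
  intermediate value theorem applies. Thus \<open>inv_into\<close> will be evaluated at a value that
  \<open>\<beta>\<close> attains.\<close>

lemma concave_on_onto_below:
  fixes \<beta> :: "real \<Rightarrow> real"
  assumes conc: "concave_on {0..} \<beta>" and lim: "(\<beta> \<longlongrightarrow> \<beta> 0) (at 0 within {0..})"
    and "\<beta> 0 \<le> v" "v \<le> \<beta> b" "0 \<le> b"
  shows "\<exists>t\<ge>0. \<beta> t = v"
proof -
  have "continuous_on {0<..} (\<lambda>x. - \<beta> x)"
    using conc unfolding concave_on_def
    by (intro convex_on_continuous) (auto elim: convex_on_subset)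
  then have c1: "continuous_on {0<..} \<beta>"
    using continuous_on_minus by fastforce
  have "continuous_on {0..} \<beta>"
    unfolding continuous_on_eq_continuous_within
  proof
    fix x :: real assume "x \<in> {0..}"
    show "continuous (at x within {0..}) \<beta>"
    proof (cases "x = 0")
      case True
      then show ?thesis using lim by (simp add: continuous_within)
    next
      case False
      then have "isCont \<beta> x" using c1 \<open>x \<in> {0..}\<close> by (auto simp: continuous_on_eq_continuous_at)
      then show ?thesis by (rule continuous_at_imp_continuous_at_within)
    qed
  qed
  then have "continuous_on {0..b} \<beta>" by (rule continuous_on_subset) auto
  from IVT'[OF assms(3,4,5) this] show ?thesis by auto
qed

section \<open>Transfer of the Poincare inequality from \<open>Y\<close> to \<open>X\<close>\<close>

theorem theorem1p10:
  fixes \<alpha> \<beta> :: "real \<Rightarrow> real"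
    and \<phi> :: "'x::banach \<Rightarrow> 'y::banach"
    and q :: real
    and A :: "real ^ 'n ^ 'n"
  defines "\<gamma>X \<equiv> spectral_gap_const A (\<lambda>w::'x. norm w powr q)"
    and "\<gamma>Y \<equiv> spectral_gap_const A (\<lambda>w::'y. norm w powr q)"
  assumes "\<exists>x::'x. x \<noteq> 0"
    and "\<exists>y::'y. y \<noteq> 0"
    and "\<alpha> \<in> {0..} \<rightarrow> {0..}"
    and "\<beta> \<in> {0..} \<rightarrow> {0..}"
    and "strict_mono_on {0..} \<alpha>"
    and "strict_mono_on {0..} \<beta>"
    and "concave_on {0..} \<beta>"
    and "(\<alpha> \<longlongrightarrow> 0) (at 0 within {0..})"
    and "(\<beta> \<longlongrightarrow> 0) (at 0 within {0..})"
    and "\<forall>x\<in>cball 0 1. \<forall>y\<in>cball 0 1.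
           \<alpha> (norm (x - y)) \<le> norm (\<phi> x - \<phi> y) \<and> norm (\<phi> x - \<phi> y) \<le> \<beta> (norm (x - y))"
    and "1 \<le> q"
    and "2 \<le> CARD('n)"
    and "symmetric_stochastic A"
  shows "\<gamma>X \<le> ennreal (8 powr (q + 1)) * \<gamma>Y
    + ennreal (8 powr q)
      / ennreal (inv_into {0..} \<beta> (\<alpha> (1/4) / (8 * enn2real \<gamma>Y powr (1/q))) powr q)"
proof (cases "\<gamma>Y = \<infinity>")
  case True
  \<comment> \<open>The first summand is already \<open>\<infinity>\<close>, whatever the second
    becomes under the default \<open>enn2real \<infinity> = 0\<close>.\<close>
  then show ?thesis by (simp add: ennreal_mult_top)
next
  case False
  have A: "(\<Sum>j\<in>UNIV. A $ i $ j) = 1" "0 \<le> A $ i $ j" for i j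
    using \<open>symmetric_stochastic A\<close> by (auto simp: symmetric_stochastic_def)
  obtain y :: 'y where y: "y \<noteq> 0" using assms(4) by blast
  obtain x0 :: 'x where x0: "x0 \<noteq> 0" using assms(3) by blast
  define g where "g = enn2real \<gamma>Y"
  have \<gamma>Y: "\<gamma>Y = ennreal g" using False unfolding g_def by (simp add: top.not_eq_extremum)
  have P: "poincare A (\<lambda>w::'y. norm w powr q) g"
    unfolding g_def \<gamma>Y_def using A False[unfolded \<gamma>Y_def]
    by (intro poincare_spectral_gap_const) auto
  have g: "1 / 2 \<le> g"
    using assms by (intro poincare_ge_half[OF P y]) (auto simp: g_def)
  have \<alpha>_mono: "mono_on {0..} \<alpha>" and \<beta>_mono: "mono_on {0..} \<beta>"
    using assms by (auto intro: strict_mono_on_imp_mono_on)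
  have \<alpha>_pos: "0 < \<alpha> (1/4)"
    using strict_mono_onD[OF \<open>strict_mono_on {0..} \<alpha>\<close>, of 0 "1/4"]
      funcset_mem[OF assms(5), of 0] by simp
  \<comment> \<open>The limit ignores the value at 0 itself; monotonicity gives
    \<open>\<beta> 0 \<le> \<beta> t\<close>, which passes to the limit.\<close>
  have \<beta>0: "\<beta> 0 = 0"
  proof (rule antisym)
    show "\<beta> 0 \<le> 0"
    proof (rule tendsto_lowerbound[OF \<open>(\<beta> \<longlongrightarrow> 0) (at 0 within {0..})\<close>])
      show "\<forall>\<^sub>F t in at 0 within {0..}. \<beta> 0 \<le> \<beta> t"
        using monotone_onD[OF \<beta>_mono, of 0] by (auto simp: eventually_at_filter)
      show "at 0 within {0..} \<noteq> (bot :: real filter)"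
        by (simp add: at_within_Ici_at_right)
    qed
  qed (use assms(6) in auto)
  define v where "v = \<alpha> (1/4) / (8 * g powr (1/q))"
  have v: "0 < v" using \<alpha>_pos g by (simp add: v_def)
  \<comment> \<open>Since \<open>g \<ge> 1/2\<close>, the denominator in \<open>v\<close> is at
    least 1. Then \<open>\<alpha> (1/4) \<le> \<beta> (1/4)\<close> follows from a pair in the ball
    at distance exactly 1/4, which a nonzero vector of \<open>X\<close> provides.\<close>
  have "v \<le> \<beta> (1/4)"
  proof -
    have "(1/2) powr 1 \<le> (1/2::real) powr (1/q)"
      using \<open>1 \<le> q\<close> by (intro powr_mono') auto
    also have "\<dots> \<le> g powr (1/q)" using g \<open>1 \<le> q\<close> by (intro powr_mono2) auto
    finally have "1 \<le> 8 * g powr (1/q)" by simp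
    then have "v \<le> \<alpha> (1/4)" using \<alpha>_pos unfolding v_def by (simp add: divide_le_eq)
    moreover have "\<alpha> (1/4) \<le> \<beta> (1/4)"
    proof -
      define u where "u = (1 / (4 * norm x0)) *\<^sub>R x0"
      have u: "norm u = 1/4" using x0 by (simp add: u_def)
      then have "\<alpha> (norm (u - 0)) \<le> \<beta> (norm (u - 0))"
        using bspec[OF bspec[OF assms(12), of u], of 0] by simp
      then show ?thesis using u by simp
    qed
    ultimately show ?thesis by linarith
  qed
  then have "\<exists>t\<ge>0. \<beta> t = v"
    using assms v \<beta>0 by (intro concave_on_onto_below) auto
  then have v_in: "v \<in> \<beta> ` {0..}" by auto
  define s where "s = inv_into {0..} \<beta> v"
  have \<beta>s: "\<beta> s = v" unfolding s_def by (rule f_inv_into_f[OF v_in])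
  have "0 \<le> s" using inv_into_into[OF v_in] by (simp add: s_def)
  then have s: "0 < s" using \<beta>s v \<beta>0 by (cases "s = 0") auto

  have PX: "poincare A (\<lambda>w::'x. norm w powr q) (8 powr (q + 1) * g + 8 powr q / s powr q)"
    unfolding poincare_def
  proof
    fix x :: "'n \<Rightarrow> 'x"
    let ?n = "real CARD('n)"
    let ?D = "\<Sum>i\<in>UNIV. \<Sum>j\<in>UNIV. norm (x i - x j) powr q"
    define T where "T = (\<Sum>i\<in>UNIV. \<Sum>j\<in>UNIV. A $ i $ j * norm (x i - x j) powr q)"
    have T: "0 \<le> T" unfolding T_def using A by (intro sum_nonneg mult_nonneg_nonneg) auto
    obtain c R where R: "0 \<le> R" "CARD('n) \<le> 2 * card {j. norm (x j - x c) \<le> R}"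
      and Rmin: "\<And>i r. CARD('n) \<le> 2 * card {j. norm (x j - x i) \<le> r} \<Longrightarrow> R \<le> r"
      using ex_half_ball[of x] by metis
    have R_bound: "?n * R powr q \<le> T / s powr q"
    proof (rule ccontr)
      assume neg: "\<not> ?thesis"
      then have "R \<noteq> 0" using T by auto
      then have Rpos: "0 < R" using R by simp
      \<comment> \<open>The factor \<open>1 / (2 * R)\<close> sends the half ball to radius 1/2,
        leaving a margin inside the unit ball, and turns the Lipschitz constant 2 of
        \<open>radial\<close> into \<open>1 / R\<close>.\<close>
      define z where "z i = radial ((1 / (2 * R)) *\<^sub>R (x i - x c))" for i
      have zin: "z i \<in> cball 0 1" for i by (simp add: z_def norm_radial_le)
      have z_lip: "norm (z i - z j) \<le> norm (x i - x j) / R" for i j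
        using radial_lipschitz[of "(1 / (2 * R)) *\<^sub>R (x i - x c)" "(1 / (2 * R)) *\<^sub>R (x j - x c)"] Rpos
        unfolding z_def by (simp flip: scaleR_right_diff_distrib)
      have "(\<Sum>i\<in>UNIV. \<Sum>j\<in>UNIV. A $ i $ j * norm (z i - z j) powr q)
          \<le> (\<Sum>i\<in>UNIV. \<Sum>j\<in>UNIV. A $ i $ j * (norm (x i - x j) / R) powr q)"
        using z_lip A \<open>1 \<le> q\<close> by (intro sum_mono mult_left_mono powr_mono2) auto
      also have "\<dots> = T / R powr q"
        using Rpos by (simp add: T_def powr_divide sum_divide_distrib)
      also have "\<dots> \<le> ?n * s powr q"
        using neg Rpos s by (simp add: field_simps)
      finally have Tz: "(\<Sum>i\<in>UNIV. \<Sum>j\<in>UNIV. A $ i $ j * norm (z i - z j) powr q) / s powr q \<le> ?n"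
        using s by (simp add: field_simps)
      have "real (card {(i, j). \<not> norm (z i - z j) < 1/4})
        \<le> 8 powr (-q) * (?n\<^sup>2 + ?n * (\<Sum>i\<in>UNIV. \<Sum>j\<in>UNIV. A $ i $ j * norm (z i - z j) powr q) / s powr q)"
        using g assms \<alpha>_mono \<beta>_mono \<alpha>_pos \<beta>0 zin s \<beta>s
        by (intro card_far_pairs_le[OF P, where \<alpha>=\<alpha> and \<beta>=\<beta> and \<phi>=\<phi>]) (auto simp: v_def)
      \<comment> \<open>As \<open>q \<ge> 1\<close>, the factor is at most 1/8; with two terms of
        size at most \<open>n\<close> squared this gives exactly the quarter that
        \<open>ex_half_row\<close> allows.\<close>
      also have "\<dots> \<le> 8 powr (-1) * (?n\<^sup>2 + ?n * ?n)"
      proof (intro mult_mono add_mono)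
        show "8 powr (-q) \<le> (8::real) powr (-1)" using \<open>1 \<le> q\<close> by (intro powr_mono) auto
        show "?n * (\<Sum>i\<in>UNIV. \<Sum>j\<in>UNIV. A $ i $ j * norm (z i - z j) powr q) / s powr q \<le> ?n * ?n"
          using mult_left_mono[OF Tz, of ?n] by simp
        show "0 \<le> ?n\<^sup>2 + ?n * (\<Sum>i\<in>UNIV. \<Sum>j\<in>UNIV. A $ i $ j * norm (z i - z j) powr q) / s powr q"
          using A by (intro add_nonneg_nonneg divide_nonneg_nonneg mult_nonneg_nonneg sum_nonneg) auto
      qed auto
      also have "\<dots> = ?n\<^sup>2 / 4" by (simp add: powr_minus power2_eq_square)
      finally have "4 * real (card {(i, j). \<not> norm (z i - z j) < 1/4}) \<le> ?n\<^sup>2" by simp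
      from ex_half_row[OF R(2) this] obtain i
        where i: "norm (x i - x c) \<le> R" "CARD('n) \<le> 2 * card {j. norm (z i - z j) < 1/4}"
        by auto
      have half: "norm ((1 / (2 * R)) *\<^sub>R (x i - x c)) \<le> 1/2"
        using i(1) Rpos unfolding norm_scaleR by (simp add: field_simps)
      then have zi: "z i = (1 / (2 * R)) *\<^sub>R (x i - x c)"
        unfolding z_def by (intro radial_eq_self) linarith
      \<comment> \<open>\<open>z j\<close> has norm below 3/4, whereas the retraction sends points
        outside the open ball to the unit sphere. So neither point was moved, and the distance 1/4
        scales back to \<open>R / 2\<close>, against the minimality of \<open>R\<close>.\<close>
      have "norm (x j - x i) \<le> R / 2" if j: "norm (z i - z j) < 1/4" for j
      proof -
        have "norm (z j) < 1" using j half norm_triangle_ineq2[of "z j" "z i"] unfolding zi[symmetric]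
          by (simp add: norm_minus_commute)
        then have "norm ((1 / (2 * R)) *\<^sub>R (x j - x c)) \<le> 1"
          using norm_radial_eq_one[of "(1 / (2 * R)) *\<^sub>R (x j - x c)"]
          unfolding z_def by fastforce
        then have "z j = (1 / (2 * R)) *\<^sub>R (x j - x c)" unfolding z_def by (rule radial_eq_self)
        then have "z i - z j = (1 / (2 * R)) *\<^sub>R (x i - x j)"
          by (simp add: zi flip: scaleR_right_diff_distrib)
        then have "norm (z i - z j) = norm (x j - x i) / (2 * R)"
          using Rpos by (simp add: norm_minus_commute)
        then have "norm (x j - x i) / (2 * R) < 1/4" using j by simp
        then show ?thesis using Rpos by (simp add: field_simps)
      qed
      then have "card {j. norm (z i - z j) < 1/4} \<le> card {j. norm (x j - x i) \<le> R / 2}"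
        by (intro card_mono) auto
      with i(2) have "R \<le> R / 2" by (intro Rmin[of i]) linarith
      then show False using Rpos by simp
    qed
    \<comment> \<open>\<open>f\<close> vanishes on the half ball and its differences are at most
      those of \<open>x\<close>, so its energy is at most \<open>T\<close>.\<close>
    define f where "f i = max 0 (norm (x i - x c) - R)" for i
    have "?n * (\<Sum>i\<in>UNIV. f i powr q) \<le> (\<Sum>i\<in>UNIV. \<Sum>j\<in>UNIV. \<bar>f i - f j\<bar> powr q)"
      by (rule sum_powr_le_sum_diff_powr[OF _ _ R(2)]) (auto simp: f_def)
    also have "\<dots> \<le> g * ?n * (\<Sum>i\<in>UNIV. \<Sum>j\<in>UNIV. A $ i $ j * \<bar>f i - f j\<bar> powr q)"
      by (rule poincare_real[OF P y])
    also have "\<dots> \<le> g * ?n * T"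
      unfolding T_def
    proof (intro mult_left_mono sum_mono powr_mono2)
      fix i j
      have "\<bar>norm (x i - x c) - norm (x j - x c)\<bar> \<le> norm (x i - x j)"
        using norm_triangle_ineq3[of "x i - x c" "x j - x c"] by simp
      then show "\<bar>f i - f j\<bar> \<le> norm (x i - x j)" unfolding f_def by linarith
    qed (use A g \<open>1 \<le> q\<close> in auto)
    finally have f_bound: "?n * (\<Sum>i\<in>UNIV. f i powr q) \<le> g * ?n * T" .
    have "?D \<le> (\<Sum>i\<in>UNIV. \<Sum>j\<in>UNIV. 4 powr q * (R powr q + f i powr q + f j powr q))"
    proof (intro sum_mono)
      fix i j
      have "norm (x i - x j) \<le> norm (x i - x c) + norm (x j - x c)"
        using norm_triangle_ineq4[of "x i - x c" "x j - x c"] by simp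
      then have "norm (x i - x j) \<le> 2 * R + f i + f j" unfolding f_def by linarith
      then have "norm (x i - x j) powr q \<le> (2 * R + f i + f j) powr q"
        using \<open>1 \<le> q\<close> by (intro powr_mono2) auto
      also have "\<dots> \<le> 4 powr q * (R powr q + f i powr q + f j powr q)"
        using R \<open>1 \<le> q\<close> by (intro add3_powr_le) (auto simp: f_def)
      finally show "norm (x i - x j) powr q
        \<le> 4 powr q * (R powr q + f i powr q + f j powr q)" .
    qed
    also have "\<dots> = 4 powr q * (?n * (?n * R powr q) + 2 * (?n * (\<Sum>i\<in>UNIV. f i powr q)))"
      by (simp add: sum.distrib flip: sum_distrib_left) (simp add: algebra_simps)
    also have "\<dots> \<le> 4 powr q * (?n * (T / s powr q) + 2 * (g * ?n * T))"
      using R_bound f_bound by (intro mult_left_mono add_mono) auto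
    also have "\<dots> = (2 * 4 powr q * g + 4 powr q / s powr q) * (?n * T)"
      by (simp add: algebra_simps)
    \<comment> \<open>The argument yields \<open>2 * 4 powr q\<close> and \<open>4 powr q\<close>,
      smaller than the stated constants.\<close>
    also have "\<dots> \<le> (8 powr (q + 1) * g + 8 powr q / s powr q) * (?n * T)"
    proof (intro mult_right_mono add_mono divide_right_mono)
      show *: "(4::real) powr q \<le> 8 powr q" using \<open>1 \<le> q\<close> by (intro powr_mono2) auto
      show "2 * 4 powr q \<le> (8::real) powr (q + 1)"
      proof -
        have "(8::real) powr (q + 1) = 8 * 8 powr q" by (simp add: powr_add)
        moreover have "0 \<le> (8::real) powr q" by (rule powr_ge_zero)
        ultimately show ?thesis using * by linarith
      qed
    qed (use g T in auto)
    finally show "?D \<le> (8 powr (q + 1) * g + 8 powr q / s powr q) * ?n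
        * (\<Sum>i\<in>UNIV. \<Sum>j\<in>UNIV. A $ i $ j * norm (x i - x j) powr q)"
      by (simp add: T_def mult.assoc)
  qed
  have "\<gamma>X \<le> ennreal (8 powr (q + 1) * g + 8 powr q / s powr q)"
    unfolding \<gamma>X_def using g s by (intro spectral_gap_const_le PX add_pos_nonneg) auto
  also have "\<dots> = ennreal (8 powr (q + 1)) * \<gamma>Y + ennreal (8 powr q) / ennreal (s powr q)"
    using g s by (simp add: \<gamma>Y ennreal_plus ennreal_mult divide_ennreal)
  finally show ?thesis unfolding s_def v_def g_def .
qed

end
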